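(* Let $\mathcal{A}=(Q,A,\delta)$ be a synchronizing deterministic finite automaton such that $|Q|>1$ is prime, there is a subset $B\subseteq A$ for which $B^*$ acts transitively on $Q$, and there are two letters $a,b\in A\cap\mathrm{Syn}(\mathcal{A})$ with $Q\cdot a\neq Q\cdot b$. Then there is a weakly reset group coloring $\chi$ of $\mathcal{A}$ such that the automata semigroup $\mathcal{S}(\mathcal{M}(\mathcal{A},\chi))$ is free.
   Context: A deterministic finite automaton (DFA) is a triple $\mathcal{A}=(Q,A,\delta)$ with $Q$ a finite set of states, $A$ a finite alphabet, and $\delta:Q\times A\to Q$; write $q\cdot a=\delta(q,a)$, extended to words of the free monoid $A^*$ and to subsets by $H\cdot u=\{q\cdot u:q\in H\}$. $\mathrm{Syn}(\mathcal{A})=\{u\in A^*:|Q\cdot u|=1\}$ is the set of reset words, and $\mathcal{A}$ is synchronizing if $\mathrm{Syn}(\mathcal{A})\neq\emptyset$. "$B^*$ acts transitively on $Q$" means that for all $p,q\in Q$ there is $u\in B^*$ with $p\cdot u=q$. A group coloring $\chi$ of $\mathcal{A}$ assigns to each edge of the underlying digraph (one edge $q\to q\cdot a$ for each pair $(q,a)\in Q\times A$) a letter of $A$ so that, for each state $q$, the map from the outgoing edges of $q$ to $A$ is a bijection. The associated Mealy automaton is $\mathcal{M}(\mathcal{A},\chi)=(Q,A,\delta,\lambda)$, where $\lambda(q,a)$ is the color of the edge given by $(q,a)$. For a Mealy automaton $\mathcal{M}=(Q,A,\delta,\lambda)$ and $q\in Q$, the transformation $\mathcal{M}_q:A^*\to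 A^*$ is defined by $\mathcal{M}_q(1)=1$ and $\mathcal{M}_q(a_0a_1\cdots a_n)=\lambda(q,a_0)\,\mathcal{M}_{q\cdot a_0}(a_1\cdots a_n)$; $\mathcal{S}(\mathcal{M})$ is the semigroup generated by $\{\mathcal{M}_q:q\in Q\}$. $\mathcal{M}$ is weakly reset if it is synchronizing (that is, the DFA $(Q,A,\delta)$ is synchronizing) and there is a non-empty two-sided ideal $H$ of $A^*$ with $H\subseteq\mathrm{Syn}(\mathcal{M})$ and $\mathcal{M}_q(H)\subseteq H$ for all $q\in Q$, where $\mathrm{Syn}(\mathcal{M})$ is the set of reset words of $(Q,A,\delta)$. A group coloring $\chi$ is weakly reset if $\mathcal{M}(\mathcal{A},\chi)$ is weakly reset. *)

theory Defs
  imports "HOL-Library.Cardinality" "HOL-Computational_Algebra.Primes"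
begin

section \<open>Deterministic finite automata\<close>

text \<open>
  A DFA is given by its transition function \<^term>\<open>\<delta> :: 'q \<Rightarrow> 'a \<Rightarrow> 'q\<close>; the state set and the
  alphabet are the (finite) types \<^typ>\<open>'q\<close> and \<^typ>\<open>'a\<close>, and the free monoid on the
  alphabet is \<^typ>\<open>'a list\<close>.
\<close>

definition run :: "('q \<Rightarrow> 'a \<Rightarrow> 'q) \<Rightarrow> 'q \<Rightarrow> 'a list \<Rightarrow> 'q" where
  "run \<delta> q u = foldl \<delta> q u"

definition run_set :: "('q \<Rightarrow> 'a \<Rightarrow> 'q) \<Rightarrow> 'q set \<Rightarrow> 'a list \<Rightarrow> 'q set" where
  "run_set \<delta> H u = (\<lambda>q. run \<delta> q u) ` H"

definition Syn :: "('q \<Rightarrow> 'a \<Rightarrow> 'q) \<Rightarrow> 'a list set" where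
  "Syn \<delta> = {u. card (run_set \<delta> UNIV u) = 1}"

definition synchronizing :: "('q \<Rightarrow> 'a \<Rightarrow> 'q) \<Rightarrow> bool" where
  "synchronizing \<delta> \<longleftrightarrow> Syn \<delta> \<noteq> {}"

definition acts_transitively :: "('q \<Rightarrow> 'a \<Rightarrow> 'q) \<Rightarrow> 'a set \<Rightarrow> bool" where
  "acts_transitively \<delta> B \<longleftrightarrow> (\<forall>p q. \<exists>u\<in>lists B. run \<delta> p u = q)"

section \<open>Mealy automata\<close>

text \<open>A Mealy automaton is a transition function \<^term>\<open>\<delta>\<close> together with an output function
  \<^term>\<open>out :: 'q \<Rightarrow> 'a \<Rightarrow> 'a\<close>.\<close>

fun mealy_map :: "('q \<Rightarrow> 'a \<Rightarrow> 'q) \<Rightarrow> ('q \<Rightarrow> 'a \<Rightarrow> 'a) \<Rightarrow> 'q \<Rightarrow> 'a list \<Rightarrow> 'a list" where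
  "mealy_map \<delta> out q [] = []"
| "mealy_map \<delta> out q (a # u) = out q a # mealy_map \<delta> out (\<delta> q a) u"

definition two_sided_ideal :: "'a list set \<Rightarrow> bool" where
  "two_sided_ideal H \<longleftrightarrow> (\<forall>u\<in>H. \<forall>x y. x @ u @ y \<in> H)"

definition weakly_reset :: "('q \<Rightarrow> 'a \<Rightarrow> 'q) \<Rightarrow> ('q \<Rightarrow> 'a \<Rightarrow> 'a) \<Rightarrow> bool" where
  "weakly_reset \<delta> out \<longleftrightarrow> synchronizing \<delta> \<and>
     (\<exists>H. H \<noteq> {} \<and> two_sided_ideal H \<and> H \<subseteq> Syn \<delta> \<and> (\<forall>q. mealy_map \<delta> out q ` H \<subseteq> H))"

section \<open>Semigroups of transformations\<close>

inductive_set generated_semigroup :: "('x \<Rightarrow> 'x) set \<Rightarrow> ('x \<Rightarrow> 'x) set"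
  for G :: "('x \<Rightarrow> 'x) set" where
  gen: "f \<in> G \<Longrightarrow> f \<in> generated_semigroup G"
| comp: "f \<in> generated_semigroup G \<Longrightarrow> g \<in> generated_semigroup G \<Longrightarrow>
         f \<circ> g \<in> generated_semigroup G"

definition automaton_semigroup ::
    "('q \<Rightarrow> 'a \<Rightarrow> 'q) \<Rightarrow> ('q \<Rightarrow> 'a \<Rightarrow> 'a) \<Rightarrow> ('a list \<Rightarrow> 'a list) set" where
  "automaton_semigroup \<delta> out = generated_semigroup (range (mealy_map \<delta> out))"

text \<open>
  A semigroup of transformations is free if it has a basis \<^term>\<open>X\<close>: evaluation of words is an
  isomorphism from the free semigroup of non-empty words over \<^term>\<open>X\<close> onto it. Evaluation
  turns concatenation into composition by construction, so bijectivity is all there is to require.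
  The basis need not be in bijection with the states of the automaton: distinct states
  may induce the same transformation.
\<close>

definition free_semigroup :: "('x \<Rightarrow> 'x) set \<Rightarrow> bool" where
  "free_semigroup S \<longleftrightarrow>
     (\<exists>X. bij_betw (\<lambda>fs. foldr (\<circ>) fs id) {fs \<in> lists X. fs \<noteq> []} S)"

section \<open>Group colorings\<close>

text \<open>
  The underlying digraph has one edge, from \<^term>\<open>q\<close> to \<^term>\<open>\<delta> q a\<close>, for each pair
  \<^term>\<open>(q, a)\<close>; parallel edges are kept apart. Edges are therefore represented by these
  pairs, and a coloring is a function on them.
\<close>

definition out_edges :: "'q \<Rightarrow> ('q \<times> 'a) set" where
  "out_edges q = {q} \<times> UNIV"

definition group_coloring :: "('q \<times> 'a \<Rightarrow> 'a) \<Rightarrow> bool" where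
  "group_coloring \<chi> \<longleftrightarrow> (\<forall>q. bij_betw \<chi> (out_edges q) UNIV)"

text \<open>The Mealy automaton of a DFA \<^term>\<open>\<delta>\<close> and a coloring \<^term>\<open>\<chi>\<close> has transition function
  \<^term>\<open>\<delta>\<close> and output function \<^term>\<open>curry \<chi>\<close>.\<close>

definition weakly_reset_coloring :: "('q \<Rightarrow> 'a \<Rightarrow> 'q) \<Rightarrow> ('q \<times> 'a \<Rightarrow> 'a) \<Rightarrow> bool" where
  "weakly_reset_coloring \<delta> \<chi> \<longleftrightarrow> group_coloring \<chi> \<and> weakly_reset \<delta> (curry \<chi>)"

end

theory Submission
  imports Defs "HOL-Combinatorics.Transposition"
begin

text \<open>
  Colour the edges so that every letter other than \<^term>\<open>a\<close> and \<^term>\<open>b\<close> keeps its name, while the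
  state \<^term>\<open>r\<close> reached by \<^term>\<open>b\<close> exchanges \<^term>\<open>a\<close> and \<^term>\<open>b\<close> and every other state
  fixes them. The words containing \<^term>\<open>a\<close> or \<^term>\<open>b\<close> form the ideal required for weak
  resetness. On words over \<^term>\<open>a\<close>, \<^term>\<open>b\<close>, read as power series over the field with two
  elements, \<^term>\<open>q\<close> acts as \<open>x \<mapsto> (1 + t) x + c\<close>, where \<open>c\<close> is 1 if \<^term>\<open>q = r\<close> and 0
  otherwise. For polynomial \<open>x\<close> the value of this at \<open>t = 1\<close> is \<open>c\<close>, so a product of such maps
  determines its constants one by one. Applying this after an arbitrary prefix of other letters
  recovers each factor as a transformation. Hence the semigroup is free on the set of distinct
  state transformations.
\<close>

section \<open>Products of generators and Mealy maps\<close>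

lemma foldr_comp_append: "foldr (\<circ>) (fs @ gs) id = foldr (\<circ>) fs id \<circ> foldr (\<circ>) gs id"
  by (induction fs) (auto simp: comp_assoc)

text \<open>This supplies the surjectivity half of freeness for any generating set, so only
  injectivity of evaluation depends on the colouring.\<close>

lemma generated_semigroup_eq_products:
  "generated_semigroup G = (\<lambda>fs. foldr (\<circ>) fs id) ` {fs \<in> lists G. fs \<noteq> []}"
proof
  show "generated_semigroup G \<subseteq> (\<lambda>fs. foldr (\<circ>) fs id) ` {fs \<in> lists G. fs \<noteq> []}"
  proof
    fix f assume "f \<in> generated_semigroup G"
    then show "f \<in> (\<lambda>fs. foldr (\<circ>) fs id) ` {fs \<in> lists G. fs \<noteq> []}"
    proof induction
      case (gen f)
      then show ?case by (intro image_eqI[of _ _ "[f]"]) auto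
    next
      case (comp f g)
      then obtain fs gs where "fs \<in> lists G" "fs \<noteq> []" "f = foldr (\<circ>) fs id"
        and "gs \<in> lists G" "gs \<noteq> []" "g = foldr (\<circ>) gs id"
        by blast
      then show ?case
        by (intro image_eqI[of _ _ "fs @ gs"]) (simp_all only: foldr_comp_append, auto)
    qed
  qed
next
  have "foldr (\<circ>) fs id \<in> generated_semigroup G" if "fs \<noteq> []" "fs \<in> lists G" for fs
    using that by (induction fs rule: list_nonempty_induct)
      (auto intro: generated_semigroup.intros)
  then show "(\<lambda>fs. foldr (\<circ>) fs id) ` {fs \<in> lists G. fs \<noteq> []} \<subseteq> generated_semigroup G"
    by blast
qed

lemma mealy_map_append:
  "mealy_map \<delta> out q (u @ v) = mealy_map \<delta> out q u @ mealy_map \<delta> out (run \<delta> q u) v"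
  by (induction u arbitrary: q) (auto simp: run_def)

lemma length_mealy_map [simp]: "length (mealy_map \<delta> out q u) = length u"
  by (induction u arbitrary: q) auto

lemma inj_mealy_map:
  assumes "\<And>q. inj (out q)"
  shows "inj (mealy_map \<delta> out q)"
proof -
  have "mealy_map \<delta> out q u = mealy_map \<delta> out q v \<Longrightarrow> u = v" for u v
  proof (induction u arbitrary: q v)
    case Nil
    then show ?case by (cases v) auto
  next
    case (Cons x u)
    then obtain y v' where "v = y # v'" by (cases v) auto
    with Cons show ?case using assms by (auto dest: injD)
  qed
  then show ?thesis by (auto intro: injI)
qed

lemma reset_letter:
  assumes "[x] \<in> Syn \<delta>"
  obtains p where "\<And>q. \<delta> q x = p"
proof -
  from assms obtain p where "range (\<lambda>q. \<delta> q x) = {p}"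
    by (auto simp: Syn_def run_set_def run_def card_1_singleton_iff)
  then show ?thesis using that by blast
qed

section \<open>The colouring attached to two reset letters\<close>

locale two_resets =
  fixes \<delta> :: "'q \<Rightarrow> 'a \<Rightarrow> 'q" and a b :: 'a and p r :: 'q
  assumes reset_a [simp]: "\<delta> q a = p"
    and reset_b [simp]: "\<delta> q b = r"
    and distinct [simp]: "p \<noteq> r"
begin

definition out :: "'q \<Rightarrow> 'a \<Rightarrow> 'a" where
  "out q = (if q = r then transpose a b else id)"

abbreviation M :: "'q \<Rightarrow> 'a list \<Rightarrow> 'a list" where
  "M \<equiv> mealy_map \<delta> out"

text \<open>Products are indexed by words of states rather than by lists of transformations, because
  \<open>act_neutral\<close> moves each state along a prefix.\<close>

primrec act :: "'q list \<Rightarrow> 'a list \<Rightarrow> 'a list" where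
  "act [] y = y"
| "act (q # us) y = M q (act us y)"

lemma foldr_comp_eq_act: "foldr (\<circ>) (map M us) id = act us"
  by (induction us) (auto simp: fun_eq_iff)

lemma letters_distinct [simp]: "a \<noteq> b" "b \<noteq> a"
  using reset_a reset_b distinct by metis+

lemma out_simps [simp]:
  "out q a = (if q = r then b else a)"
  "out q b = (if q = r then a else b)"
  "x \<notin> {a, b} \<Longrightarrow> out q x = x"
  by (auto simp: out_def)

lemma bij_out: "bij (out q)"
  by (simp add: out_def)

lemma inj_M: "inj (M q)"
  by (intro inj_mealy_map bij_is_inj bij_out)

section \<open>Words over \<open>a\<close> and \<open>b\<close>\<close>

lemma M_ab: "y \<in> lists {a, b} \<Longrightarrow> M q y \<in> lists {a, b}"
  by (induction y arbitrary: q) (auto split: if_splits)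

lemma act_ab: "y \<in> lists {a, b} \<Longrightarrow> act us y \<in> lists {a, b}"
  by (induction us) (simp_all only: act.simps M_ab)

text \<open>The first letter is already a reset, so the initial state influences only the first
  output letter.\<close>

lemma M_cong_ab:
  "y \<in> lists {a, b} \<Longrightarrow> (q = r) = (q' = r) \<Longrightarrow> M q y = M q' y"
  by (cases y) auto

text \<open>An output letter is \<open>b\<close> iff exactly one of the current and the preceding
  input letter is \<open>b\<close>, where starting in \<open>r\<close> counts as a preceding
  \<open>b\<close>. Modulo 2 the sum telescopes, leaving the initial state and the last
  letter.\<close>

lemma odd_count_M:
  assumes "y \<noteq> []" "y \<in> lists {a, b}"
  shows "odd (count_list (M q y) b) \<longleftrightarrow> (q = r) \<noteq> (last y = b)"
  using assms
proof (induction y arbitrary: q rule: list_nonempty_induct)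
  case (single x)
  then have "x = a \<or> x = b" by simp
  then show ?case by (elim disjE) simp_all
next
  case (cons x y)
  then have "x = a \<or> x = b" and "y \<in> lists {a, b}" by simp_all
  then show ?case
    using cons.IH[of "\<delta> q x"] cons.hyps distinct by (elim disjE) (auto simp del: in_lists_conv_set)
qed

lemma M_p_replicate: "M p (replicate k a) = replicate k a"
  by (induction k) auto

text \<open>
  Padding by the letter \<^term>\<open>a\<close> stands for the zero tail of a polynomial, whose degree grows by
  at most one with each factor.
\<close>

lemma act_replicate:
  "\<exists>z'. act us (z @ replicate (k + length us) a) = z' @ replicate k a"
proof (induction us arbitrary: k)
  case (Cons q us)
  from Cons[of "Suc k"] obtain z'
    where "act us (z @ replicate (Suc k + length us) a) = z' @ replicate (Suc k) a" by blast
  then have "act (q # us) (z @ replicate (k + length (q # us)) a) = M q (z' @ a # replicate k a)"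
    by simp
  \<comment> \<open>The first padding letter resets the state to \<open>p\<close>, which copies the
    remaining ones, so each factor spoils at most one of them.\<close>
  also have "\<dots> = (M q z' @ [out (run \<delta> q z') a]) @ replicate k a"
    by (simp add: mealy_map_append M_p_replicate del: out_simps)
  finally show ?case by blast
qed auto

text \<open>Since \<open>length us < k\<close>, some padding survives the inner factors. The
  outermost factor thus reads a word ending in \<open>a\<close>, and the parity of its output
  reveals whether \<open>q = r\<close>.\<close>

lemma odd_count_act:
  assumes "z \<in> lists {a, b}" "length us < k"
  shows "odd (count_list (act (q # us) (z @ replicate k a)) b) \<longleftrightarrow> q = r"
proof -
  let ?y = "act us (z @ replicate k a)"
  obtain z' where "?y = z' @ replicate (k - length us) a"
    using act_replicate[of us z "k - length us"] assms(2) by auto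
  then have nonempty: "?y \<noteq> []" and last: "last ?y = a" using assms(2) by auto
  have "?y \<in> lists {a, b}"
    using assms(1) by (intro act_ab) auto
  from odd_count_M[OF nonempty this, of q] show ?thesis
    by (simp only: act.simps last letters_distinct) blast
qed

text \<open>Two padded inputs whose numbers of \<open>b\<close> have different parities yield
  outputs of equal parity, so they cannot both be fixed.\<close>

lemma act_nontrivial_ab: "\<exists>y\<in>lists {a, b}. act (q # us) y \<noteq> y"
proof (rule ccontr)
  let ?A = "replicate (Suc (length us)) a"
  assume "\<not> ?thesis"
  then have id: "act (q # us) y = y" if "y \<in> lists {a, b}" for y using that by blast
  have "act (q # us) ([] @ ?A) = [] @ ?A" "act (q # us) ([b] @ ?A) = [b] @ ?A"
    by (rule id; auto)+
  moreover have "odd (count_list (act (q # us) ([] @ ?A)) b) \<longleftrightarrow> q = r"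
    "odd (count_list (act (q # us) ([b] @ ?A)) b) \<longleftrightarrow> q = r"
    by (rule odd_count_act; simp)+
  moreover have "even (count_list ([] @ ?A) b)" "odd (count_list ([b] @ ?A) b)"
    by auto
  ultimately show False by metis
qed

text \<open>Parity identifies the outermost factor on words over \<open>a\<close> and
  \<open>b\<close>; injectivity of \<open>M q\<close> then cancels it.\<close>

lemma act_ab_determines:
  assumes "\<And>y. y \<in> lists {a, b} \<Longrightarrow> act us y = act vs y"
  shows "map (\<lambda>q. q = r) us = map (\<lambda>q. q = r) vs"
  using assms
proof (induction us arbitrary: vs)
  case Nil
  then have id: "act vs y = y" if "y \<in> lists {a, b}" for y using that by (metis act.simps(1))
  have "vs = []"
  proof (cases vs)
    case (Cons q vs')
    then show ?thesis using act_nontrivial_ab[of q vs'] id by metis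
  qed
  then show ?case by simp
next
  case (Cons q us)
  note eq = Cons.prems
  obtain q' vs' where vs: "vs = q' # vs'"
  proof (cases vs)
    case Nil
    then have "act (q # us) y = y" if "y \<in> lists {a, b}" for y
      using eq[OF that] Nil by (simp only: act.simps(1))
    then show ?thesis using act_nontrivial_ab[of q us] by metis
  qed
  \<comment> \<open>The padding exceeds the lengths of both tails, so a single input tests both
    products.\<close>
  let ?A = "replicate (Suc (length us + length vs')) a"
  have same: "(q = r) = (q' = r)"
  proof -
    have "odd (count_list (act (q # us) ([] @ ?A)) b) \<longleftrightarrow> q = r"
      "odd (count_list (act (q' # vs') ([] @ ?A)) b) \<longleftrightarrow> q' = r"
      by (rule odd_count_act; simp)+
    moreover have "act (q # us) ([] @ ?A) = act (q' # vs') ([] @ ?A)"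
      using eq[of "[] @ ?A"] unfolding vs by fastforce
    ultimately show ?thesis by metis
  qed
  have "act us y = act vs' y" if y: "y \<in> lists {a, b}" for y
  proof -
    have "M q (act us y) = M q' (act vs' y)"
      using eq[OF y] by (simp add: vs)
    also have "\<dots> = M q (act vs' y)"
      using M_cong_ab[OF act_ab[OF y]] same by metis
    finally show ?thesis using inj_M injD by metis
  qed
  then have "map (\<lambda>q. q = r) us = map (\<lambda>q. q = r) vs'" by (rule Cons.IH)
  then show ?case by (simp only: vs list.map same)
qed

section \<open>Prefixes of letters other than \<open>a\<close> and \<open>b\<close>\<close>

lemma M_neutral:
  "w \<in> lists (- {a, b}) \<Longrightarrow> M q (w @ y) = w @ M (run \<delta> q w) y"
  by (induction w arbitrary: q) (auto simp: run_def)

lemma act_neutral: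
  assumes "w \<in> lists (- {a, b})"
  shows "act us (w @ y) = w @ act (map (\<lambda>q. run \<delta> q w) us) y"
  by (induction us) (simp_all add: M_neutral[OF assms])

text \<open>Up to the first \<open>a\<close> or \<open>b\<close> the output copies the input. At
  that letter only being in \<open>r\<close> or not matters, and afterwards both runs are in the
  same state.\<close>

lemma M_eqI:
  assumes "\<And>w. w \<in> lists (- {a, b}) \<Longrightarrow> (run \<delta> q w = r) = (run \<delta> q' w = r)"
  shows "M q = M q'"
proof
  fix u
  show "M q u = M q' u" using assms
  proof (induction u arbitrary: q q')
    case (Cons x u)
    have same: "(q = r) = (q' = r)" using Cons.prems[of "[]"] by (simp add: run_def)
    show ?case
    proof (cases "x \<in> {a, b}")
      case True
      then show ?thesis using same by auto
    next
      case False
      have "(run \<delta> (\<delta> q x) w = r) = (run \<delta> (\<delta> q' x) w = r)" if "w \<in> lists (- {a, b})" for w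
        using Cons.prems[of "x # w"] that False by (auto simp: run_def)
      then have "M (\<delta> q x) u = M (\<delta> q' x) u" by (rule Cons.IH)
      then show ?thesis using False by simp
    qed
  qed simp
qed

text \<open>Inputs \<open>w @ y\<close> compare the states reached along each neutral
  \<open>w\<close>, position by position. By \<open>M_eqI\<close> this yields equal transformations,
  though the states themselves may differ.\<close>

lemma act_determines:
  assumes "act us = act vs"
  shows "map M us = map M vs"
proof -
  have key: "map (\<lambda>q. run \<delta> q w = r) us = map (\<lambda>q. run \<delta> q w = r) vs"
    if w: "w \<in> lists (- {a, b})" for w
  proof -
    have "act (map (\<lambda>q. run \<delta> q w) us) y = act (map (\<lambda>q. run \<delta> q w) vs) y" for y
      using fun_cong[OF assms, of "w @ y"] by (simp only: act_neutral[OF w] same_append_eq)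
    then show ?thesis
      using act_ab_determines[of "map (\<lambda>q. run \<delta> q w) us" "map (\<lambda>q. run \<delta> q w) vs"]
      by (simp add: comp_def)
  qed
  have len: "length us = length vs" using key[of "[]"] map_eq_imp_length_eq by fastforce
  have "M (us ! i) = M (vs ! i)" if "i < length us" for i
  proof (rule M_eqI)
    fix w assume "w \<in> lists (- {a, b})"
    from arg_cong[OF key[OF this], of "\<lambda>l. l ! i"]
    show "(run \<delta> (us ! i) w = r) = (run \<delta> (vs ! i) w = r)" using that len by simp
  qed
  then show ?thesis using len by (intro nth_equalityI) auto
qed

lemma free_automaton_semigroup: "free_semigroup (automaton_semigroup \<delta> out)"
  unfolding free_semigroup_def
proof (intro exI[of _ "range M"] bij_betw_imageI inj_onI)
  have states: "\<exists>us. fs = map M us" if "fs \<in> lists (range M)" for fs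
    using that unfolding ex_map_conv by (auto simp: in_lists_conv_set)
  fix fs gs :: "('a list \<Rightarrow> 'a list) list"
  assume fs: "fs \<in> {fs \<in> lists (range M). fs \<noteq> []}"
    and gs: "gs \<in> {fs \<in> lists (range M). fs \<noteq> []}"
    and eq: "foldr (\<circ>) fs id = foldr (\<circ>) gs id"
  obtain us where us: "fs = map M us" using states[of fs] fs by fast
  obtain vs where vs: "gs = map M vs" using states[of gs] gs by fast
  show "fs = gs"
    using eq unfolding us vs foldr_comp_eq_act by (rule act_determines)
qed (simp only: automaton_semigroup_def generated_semigroup_eq_products)

section \<open>Weak resetness and the conclusion\<close>

lemma run_const:
  assumes "a \<in> set u \<or> b \<in> set u"
  shows "run \<delta> q u = run \<delta> q' u"
  using assms by (induction u arbitrary: q q') (auto simp: run_def)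

lemma M_mentions_ab: "a \<in> set u \<or> b \<in> set u \<Longrightarrow> a \<in> set (M q u) \<or> b \<in> set (M q u)"
  by (induction u arbitrary: q) (auto split: if_splits)

lemma weakly_reset: "weakly_reset \<delta> out"
proof -
  let ?H = "{u. a \<in> set u \<or> b \<in> set u}"
  have syn: "?H \<subseteq> Syn \<delta>"
  proof
    fix u assume "u \<in> ?H"
    then have "run_set \<delta> UNIV u = {run \<delta> p u}"
      using run_const by (force simp: run_set_def)
    then show "u \<in> Syn \<delta>" by (simp add: Syn_def)
  qed
  moreover have "[a] \<in> ?H" by simp
  moreover have "two_sided_ideal ?H" by (auto simp: two_sided_ideal_def)
  moreover have "M q ` ?H \<subseteq> ?H" for q using M_mentions_ab by auto
  ultimately show ?thesis unfolding weakly_reset_def synchronizing_def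
    by (intro conjI exI[of _ ?H]) blast+
qed

end

theorem proposition6:
  fixes \<delta> :: "'q::finite \<Rightarrow> 'a::finite \<Rightarrow> 'q"
    and B :: "'a set"
    and a b :: 'a
  assumes "synchronizing \<delta>"
    and "CARD('q) > 1" and "prime CARD('q)"
    and "acts_transitively \<delta> B"
    and "[a] \<in> Syn \<delta>" and "[b] \<in> Syn \<delta>"
    and "run_set \<delta> UNIV [a] \<noteq> run_set \<delta> UNIV [b]"
  shows "\<exists>\<chi>. weakly_reset_coloring \<delta> \<chi> \<and> free_semigroup (automaton_semigroup \<delta> (curry \<chi>))"
proof -
  obtain p where p: "\<And>q. \<delta> q a = p" using assms(5) reset_letter by metis
  obtain r where r: "\<And>q. \<delta> q b = r" using assms(6) reset_letter by metis
  have "p \<noteq> r" using assms(7) p r by (auto simp: run_set_def run_def)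
  with p r interpret two_resets \<delta> a b p r by unfold_locales
  have "bij_betw (\<lambda>(q, x). out q x) (out_edges q) UNIV" for q
  proof -
    have "bij_betw snd (out_edges q) UNIV"
      by (auto simp: out_edges_def bij_betw_def inj_on_def image_iff)
    then have "bij_betw (out q \<circ> snd) (out_edges q) UNIV"
      using bij_out bij_betw_trans by blast
    then show ?thesis
      by (rule bij_betw_cong[THEN iffD1, rotated]) (auto simp: out_edges_def)
  qed
  then have "weakly_reset_coloring \<delta> (case_prod out)"
    using weakly_reset by (simp add: weakly_reset_coloring_def group_coloring_def)
  then show ?thesis
    using free_automaton_semigroup by (intro exI[of _ "case_prod out"]) simp
qed

end
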